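(* Let $V$ be a finite subset of $\mathbb{Z}_{>0}$ such that $\max V$ is even and $\min V$ is odd. Then $\Gamma_V$ is a Ferrers graph with $R = E(V)$ and $C = O(V)$ (where $E(V)$ and $O(V)$ are each indexed in increasing order). Moreover, the partition associated to $\Gamma_V$ is $\lambda(V)$. Conversely, given a Ferrers graph $G$, there is a finite subset $V$ of $\mathbb{Z}_{>0}$ such that $\Gamma_V \cong G$.
   Context: For a finite subset $V$ of $\mathbb{Z}_{>0}$, $\Gamma_V$ is the graph with vertex set $V$ and with an edge $\{2i-1,2j\}$ for each odd $2i-1\in V$ and even $2j \in V$ with $2i-1<2j$ (and no other edges). $O(V)$ and $E(V)$ denote the sets of odd and even elements of $V$. A Ferrers graph is a bipartite graph with vertex partition $R=\{r_1,\dots,r_n\}$ and $C=\{c_1,\dots,c_m\}$ such that if $\{r_i,c_j\}$ is an edge then $\{r_\ell,c_k\}$ is an edge for all $i\le \ell\le n$ and $1\le k\le j$, and such that $\{r_1,c_1\}$ and $\{r_n,c_m\}$ are edges. The partition associated to it is $(\lambda_n,\dots,\lambda_1)$, where $\lambda_i$ is the degree of $r_i$. The partition type $\lambda(V)$: if $O(V)=\{2i_1-1<\cdots<2i_n-1\}$ and $E(V)=\{2j_1<\cdots<2j_m\}$, put $\lambda_k=\#\{a : 2i_a-1<2j_k\}$ for $k\in\{1,\dots,m\}$; then $\lambda(V)=(\lambda_m,\dots,\lambda_1)$. *)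

theory Defs
  imports Main
begin

record 'a graph =
  verts :: "'a set"
  edges :: "'a set set"

text \<open>The record does not constrain the edges; \<open>bipartite_with\<close> below makes every edge a
  two-element set of vertices, so the graph is simple.\<close>

definition bipartite_with :: "'a graph \<Rightarrow> 'a set \<Rightarrow> 'a set \<Rightarrow> bool" where
  "bipartite_with G R C \<longleftrightarrow>
     verts G = R \<union> C \<and> R \<inter> C = {} \<and> edges G \<subseteq> {{r, c} | r c. r \<in> R \<and> c \<in> C}"

definition degree :: "'a graph \<Rightarrow> 'a \<Rightarrow> nat" where
  "degree G v = card {e \<in> edges G. v \<in> e}"

definition graph_isomorphic :: "'a graph \<Rightarrow> 'b graph \<Rightarrow> bool" where
  "graph_isomorphic G H \<longleftrightarrow>
     (\<exists>f. bij_betw f (verts G) (verts H) \<and>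
          (\<forall>u\<in>verts G. \<forall>v\<in>verts G. {u, v} \<in> edges G \<longleftrightarrow> {f u, f v} \<in> edges H))"

text \<open>The indexed parts \<open>R = {r\<^sub>1, \<dots>, r\<^sub>n}\<close> and \<open>C = {c\<^sub>1, \<dots>, c\<^sub>m}\<close> are distinct lists;
  \<open>r\<^sub>i\<close> is \<open>rs ! (i - 1)\<close>. Both lists are nonempty because \<open>{r\<^sub>1, c\<^sub>1}\<close> is an edge.\<close>

definition ferrers_graph_with :: "'a graph \<Rightarrow> 'a list \<Rightarrow> 'a list \<Rightarrow> bool" where
  "ferrers_graph_with G rs cs \<longleftrightarrow>
     distinct rs \<and> distinct cs \<and> rs \<noteq> [] \<and> cs \<noteq> [] \<and>
     bipartite_with G (set rs) (set cs) \<and>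
     (\<forall>i < length rs. \<forall>j < length cs. {rs ! i, cs ! j} \<in> edges G \<longrightarrow>
        (\<forall>l k. i \<le> l \<and> l < length rs \<and> k \<le> j \<longrightarrow> {rs ! l, cs ! k} \<in> edges G)) \<and>
     {hd rs, hd cs} \<in> edges G \<and> {last rs, last cs} \<in> edges G"

definition ferrers_graph :: "'a graph \<Rightarrow> bool" where
  "ferrers_graph G \<longleftrightarrow> (\<exists>rs cs. ferrers_graph_with G rs cs)"

definition ferrers_partition :: "'a graph \<Rightarrow> 'a list \<Rightarrow> nat list" where
  "ferrers_partition G rs = rev (map (degree G) rs)"

definition odds :: "nat set \<Rightarrow> nat set" where
  "odds V = {x \<in> V. odd x}"

definition evens :: "nat set \<Rightarrow> nat set" where
  "evens V = {x \<in> V. even x}"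

definition Gamma :: "nat set \<Rightarrow> nat graph" where
  "Gamma V = \<lparr>verts = V, edges = {{x, y} | x y. x \<in> odds V \<and> y \<in> evens V \<and> x < y}\<rparr>"

definition partition_type :: "nat set \<Rightarrow> nat list" where
  "partition_type V =
     (let os = sorted_list_of_set (odds V); es = sorted_list_of_set (evens V)
      in rev (map (\<lambda>k. card {a. a < length os \<and> os ! a < es ! k}) [0..<length es]))"

end

theory Submission
  imports Defs
begin

text \<open>
  The neighbourhood of an even vertex \<open>y\<close> of \<open>\<Gamma>\<^sub>V\<close> is the set of odd elements of \<open>V\<close> below \<open>y\<close>:
  an initial segment of the odd elements that grows with \<open>y\<close>. This is exactly the nesting that
  defines a Ferrers graph, and the size of the segment is at once the degree of \<open>y\<close> and its entry
  of \<open>\<lambda>(V)\<close>. The conditions on \<open>min V\<close> and \<open>max V\<close> put the least odd element below all even ones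
  and the greatest even element above all odd ones, which gives the two corner edges.

  Conversely, in a Ferrers graph each \<open>r\<^sub>i\<close> is adjacent to an initial segment of \<open>C\<close>, of length
  \<open>d\<^sub>i\<close> say. So it is enough to place \<open>r\<^sub>i\<close> at an even number that exceeds precisely the first
  \<open>d\<^sub>i\<close> of the odd numbers assigned to \<open>C\<close>. Spacing the odd numbers \<open>2n\<close> apart, where
  \<open>n = |R|\<close>, leaves \<open>n\<close> even numbers in each gap, so that every \<open>r\<^sub>i\<close> has a place of its own
  whichever gap it must go into (lemma \<open>ferrers_graph_realizable\<close>).
\<close>

section \<open>The graph of a set of positive integers\<close>

lemma edge_Gamma_iff:
  assumes "odd x" "even y"
  shows "{x, y} \<in> edges (Gamma V) \<longleftrightarrow> x \<in> V \<and> y \<in> V \<and> x < y"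
  using assms by (auto simp: Gamma_def odds_def evens_def doubleton_eq_iff)

lemma edge_Gamma_parity:
  assumes "{x, y} \<in> edges (Gamma V)"
  shows "odd x \<longleftrightarrow> even y"
  using assms by (auto simp: Gamma_def odds_def evens_def doubleton_eq_iff)

lemma degree_Gamma_even:
  assumes "y \<in> evens V"
  shows "degree (Gamma V) y = card {x \<in> odds V. x < y}"
proof -
  have "{e \<in> edges (Gamma V). y \<in> e} = (\<lambda>x. {x, y}) ` {x \<in> odds V. x < y}"
    using assms by (auto simp: Gamma_def odds_def evens_def)
  moreover have "inj_on (\<lambda>x. {x, y}) {x \<in> odds V. x < y}"
    by (auto simp: inj_on_def doubleton_eq_iff)
  ultimately show ?thesis
    by (simp add: degree_def card_image)
qed

lemma card_nth_less:
  fixes xs :: "'b :: ord list"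
  assumes "distinct xs"
  shows "card {a. a < length xs \<and> xs ! a < y} = card {x \<in> set xs. x < y}"
proof -
  have "{x \<in> set xs. x < y} = (!) xs ` {a. a < length xs \<and> xs ! a < y}"
    by (auto simp: in_set_conv_nth)
  moreover have "inj_on ((!) xs) {a. a < length xs \<and> xs ! a < y}"
    using assms by (auto simp: inj_on_def nth_eq_iff_index_eq)
  ultimately show ?thesis
    by (simp add: card_image)
qed

lemma ferrers_partition_Gamma:
  assumes "finite V"
  shows "ferrers_partition (Gamma V) (sorted_list_of_set (evens V)) = partition_type V"
proof -
  let ?es = "sorted_list_of_set (evens V)" and ?os = "sorted_list_of_set (odds V)"
  have fin: "finite (evens V)" "finite (odds V)"
    using assms by (auto simp: evens_def odds_def)
  have "degree (Gamma V) (?es ! k) = card {a. a < length ?os \<and> ?os ! a < ?es ! k}"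
    if "k < length ?es" for k
  proof -
    have "?es ! k \<in> evens V"
      using nth_mem[OF that] fin by simp
    then show ?thesis
      using fin card_nth_less[of ?os "?es ! k"] by (simp add: degree_Gamma_even)
  qed
  then have "map (degree (Gamma V)) ?es =
      map (\<lambda>k. card {a. a < length ?os \<and> ?os ! a < ?es ! k}) [0..<length ?es]"
    by (intro nth_equalityI) auto
  then show ?thesis
    by (simp only: ferrers_partition_def partition_type_def Let_def)
qed

lemma sorted_hd_le:
  "sorted xs \<Longrightarrow> x \<in> set xs \<Longrightarrow> hd xs \<le> x"
  by (cases xs) auto

lemma sorted_le_last:
  "sorted xs \<Longrightarrow> x \<in> set xs \<Longrightarrow> x \<le> last xs"
  by (cases xs rule: rev_cases) (auto simp: sorted_append)

lemma ferrers_graph_with_Gamma: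
  assumes "finite V" "V \<noteq> {}" "even (Max V)" "odd (Min V)"
  shows "ferrers_graph_with (Gamma V) (sorted_list_of_set (evens V)) (sorted_list_of_set (odds V))"
proof -
  define es where "es = sorted_list_of_set (evens V)"
  define os where "os = sorted_list_of_set (odds V)"
  have fin: "finite (evens V)" "finite (odds V)"
    using assms(1) by (auto simp: evens_def odds_def)
  have set_es: "set es = evens V" and set_os: "set os = odds V"
    using fin by (auto simp: es_def os_def)
  have sorted: "sorted es" "sorted os" and distinct: "distinct es" "distinct os"
    by (auto simp: es_def os_def)
  have mem: "Max V \<in> set es" "Min V \<in> set os"
    using assms by (auto simp: set_es set_os evens_def odds_def)
  then have ne: "es \<noteq> []" "os \<noteq> []"
    by auto
  have edge: "{y, x} \<in> edges (Gamma V) \<longleftrightarrow> x \<le> y" if "y \<in> set es" "x \<in> set os" for x y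
  proof -
    from that have "odd x" "even y" "x \<in> V" "y \<in> V"
      by (auto simp: set_es set_os evens_def odds_def)
    \<comment> \<open>Numbers of opposite parity are distinct, so the strict inequality may be weakened.\<close>
    then show ?thesis
      by (subst insert_commute) (auto simp: edge_Gamma_iff order.strict_iff_order)
  qed
  have bip: "bipartite_with (Gamma V) (set es) (set os)"
    unfolding bipartite_with_def set_es set_os
    by (auto simp: Gamma_def evens_def odds_def)
  have nested: "{es ! l, os ! k} \<in> edges (Gamma V)"
    if "i < length es" "j < length os" "{es ! i, os ! j} \<in> edges (Gamma V)"
      "i \<le> l" "l < length es" "k \<le> j" for i j k l
  proof -
    have "os ! k \<le> os ! j" "es ! i \<le> es ! l"
      using sorted that by (auto intro: sorted_nth_mono)
    moreover have "os ! j \<le> es ! i"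
      using that edge by auto
    ultimately show ?thesis
      using that edge by auto
  qed
  have "hd es \<in> V" "last os \<in> V"
    using ne hd_in_set[of es] last_in_set[of os]
    by (auto simp: set_es set_os evens_def odds_def)
  then have "Min V \<le> hd es" "last os \<le> Max V"
    using assms(1) by auto
  then have "hd os \<le> hd es" "last os \<le> last es"
    using sorted_hd_le[OF sorted(2) mem(2)] sorted_le_last[OF sorted(1) mem(1)] by linarith+
  then have "{hd es, hd os} \<in> edges (Gamma V)" "{last es, last os} \<in> edges (Gamma V)"
    using ne by (auto simp: edge)
  then show ?thesis
    unfolding es_def[symmetric] os_def[symmetric] ferrers_graph_with_def
    using distinct ne bip nested by blast
qed

section \<open>Realizing Ferrers graphs\<close>

lemma down_closed_eq_lessThan_card:
  fixes D :: "nat set"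
  assumes "finite D" "\<And>j k. j \<in> D \<Longrightarrow> k \<le> j \<Longrightarrow> k \<in> D"
  shows "D = {..<card D}"
proof -
  have "{..<j} \<subset> D" if "j \<in> D" for j
    using assms(2) that by force
  then have below: "j < card D" if "j \<in> D" for j
    using psubset_card_mono[OF assms(1), of "{..<j}"] that by simp
  show ?thesis
    by (rule card_subset_eq) (auto simp: below)
qed

lemma ferrers_graph_with_neighbours:
  assumes "ferrers_graph_with G rs cs"
  obtains d where
    "\<And>i j. i < length rs \<Longrightarrow> j < length cs \<Longrightarrow> {rs ! i, cs ! j} \<in> edges G \<longleftrightarrow> j < d i"
proof
  fix i j assume ij: "i < length rs" "j < length cs"
  define D where "D = {j. j < length cs \<and> {rs ! i, cs ! j} \<in> edges G}"
  have "k \<in> D" if "j \<in> D" "k \<le> j" for j k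
  proof -
    have "k < length cs" "{rs ! i, cs ! k} \<in> edges G"
      using that ij assms by (auto simp: D_def ferrers_graph_with_def)
    then show ?thesis
      by (simp add: D_def)
  qed
  then have "D = {..<card D}"
    by (intro down_closed_eq_lessThan_card) (auto simp: D_def)
  then have "j \<in> D \<longleftrightarrow> j < card D"
    by blast
  then show "{rs ! i, cs ! j} \<in> edges G \<longleftrightarrow>
      j < card {j. j < length cs \<and> {rs ! i, cs ! j} \<in> edges G}"
    using ij by (simp add: D_def)
qed

lemma bipartite_with_no_edge:
  assumes "bipartite_with G R C" "u \<in> R \<and> v \<in> R \<or> u \<in> C \<and> v \<in> C"
  shows "{u, v} \<notin> edges G"
  using assms by (fastforce simp: bipartite_with_def doubleton_eq_iff)

text \<open>
  With \<open>n = |R|\<close>, the \<open>j\<close>-th vertex of \<open>C\<close> goes to \<open>2n(j + 1) + 1\<close>, counting from \<open>0\<close>. The even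
  numbers \<open>2(nd + 1), \<dots>, 2(nd + n)\<close> then lie above exactly the first \<open>d\<close> of these odd numbers,
  and the \<open>i\<close>-th vertex of \<open>R\<close>, if it has \<open>d\<close> neighbours, takes the \<open>i\<close>-th of them.
\<close>

lemma ferrers_graph_realizable:
  assumes "ferrers_graph G"
  obtains V :: "nat set" where "finite V" "V \<subseteq> {0<..}" "graph_isomorphic (Gamma V) G"
proof -
  obtain rs cs where F: "ferrers_graph_with G rs cs"
    using assms by (auto simp: ferrers_graph_def)
  then obtain d where d: "\<And>i j. i < length rs \<Longrightarrow> j < length cs \<Longrightarrow>
      {rs ! i, cs ! j} \<in> edges G \<longleftrightarrow> j < d i"
    using ferrers_graph_with_neighbours by blast
  have dist: "distinct rs" "distinct cs" and bip: "bipartite_with G (set rs) (set cs)"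
    using F by (auto simp: ferrers_graph_with_def)
  have G: "verts G = set rs \<union> set cs" "set rs \<inter> set cs = {}"
    using bip by (auto simp: bipartite_with_def)
  define n where "n = length rs"
  have "n > 0"
    using F by (simp add: n_def ferrers_graph_with_def)
  define ev where "ev i = 2 * (n * d i + i + 1)" for i
  define od where "od j = 2 * (n * (j + 1)) + 1" for j
  have even_ev [simp]: "even (ev i)" and odd_od [simp]: "odd (od j)" for i j
    by (simp_all add: ev_def od_def)
  define V where "V = ev ` {..<length rs} \<union> od ` {..<length cs}"

  have less_iff: "od j < ev i \<longleftrightarrow> j < d i" if "i < length rs" for i j
  proof
    assume "j < d i"
    then have "n * (j + 1) \<le> n * d i"
      by (intro mult_le_mono2) simp
    then show "od j < ev i"
      by (simp add: ev_def od_def)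
  next
    assume less: "od j < ev i"
    show "j < d i"
    proof (rule ccontr)
      assume "\<not> j < d i"
      then have "n * d i \<le> n * j"
        by (intro mult_le_mono2) simp
      moreover have "i + 1 \<le> n"
        using that by (simp add: n_def)
      ultimately have "n * d i + i + 1 \<le> n * (j + 1)"
        unfolding distrib_left mult_1_right by linarith
      then show False
        using less by (simp add: ev_def od_def)
    qed
  qed

  \<comment> \<open>The isomorphism reads the index of a vertex off its number; it is injective because the
    lists \<open>rs\<close> and \<open>cs\<close> are distinct and disjoint.\<close>
  define f where
    "f x = (if even x then rs ! ((x div 2 - 1) mod n) else cs ! (x div 2 div n - 1))" for x
  have f_ev: "f (ev i) = rs ! i" if "i < length rs" for i
    using that by (simp add: f_def ev_def n_def)
  have f_od: "f (od j) = cs ! j" for j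
    using \<open>n > 0\<close> by (simp add: f_def od_def)

  have bij: "bij_betw f V (verts G)"
  proof (rule bij_betw_imageI)
    have "rs ! i \<noteq> cs ! j" if "i < length rs" "j < length cs" for i j
      using that G(2) nth_mem by fastforce
    then show "inj_on f V"
      using dist by (fastforce simp: inj_on_def V_def f_ev f_od nth_eq_iff_index_eq)
    have "f ` V = (!) rs ` {..<length rs} \<union> (!) cs ` {..<length cs}"
      by (simp add: V_def image_Un image_image f_ev f_od)
    then show "f ` V = verts G"
      by (auto simp: G(1) in_set_conv_nth)
  qed

  have edge: "{ev i, od j} \<in> edges (Gamma V) \<longleftrightarrow> {rs ! i, cs ! j} \<in> edges G"
    if "i < length rs" "j < length cs" for i j
  proof -
    have "{od j, ev i} \<in> edges (Gamma V) \<longleftrightarrow> od j < ev i"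
      using that by (subst edge_Gamma_iff) (auto simp: V_def)
    then show ?thesis
      using that by (simp add: less_iff d insert_commute[of "od j"])
  qed
  have iso: "{u, v} \<in> edges (Gamma V) \<longleftrightarrow> {f u, f v} \<in> edges G" if "u \<in> V" "v \<in> V" for u v
  proof -
    have index: "(\<exists>i < length rs. x = ev i) \<or> (\<exists>j < length cs. x = od j)" if "x \<in> V" for x
      using that by (auto simp: V_def)
    consider (ee) i j where "i < length rs" "j < length rs" "u = ev i" "v = ev j"
      | (eo) i j where "i < length rs" "j < length cs" "u = ev i" "v = od j"
      | (oe) i j where "i < length rs" "j < length cs" "v = ev i" "u = od j"
      | (oo) i j where "i < length cs" "j < length cs" "u = od i" "v = od j"
      using index[OF \<open>u \<in> V\<close>] index[OF \<open>v \<in> V\<close>] by blast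
    then show ?thesis
    proof cases
      case ee
      then show ?thesis
        using edge_Gamma_parity[of u v V] bipartite_with_no_edge[OF bip, of "f u" "f v"]
        by (auto simp: f_ev)
    next
      case eo
      then show ?thesis
        by (simp add: f_ev f_od edge)
    next
      case oe
      then show ?thesis
        using edge[of i j]
        by (simp add: f_ev f_od insert_commute[of "od j"] insert_commute[of "cs ! j"])
    next
      case oo
      then show ?thesis
        using edge_Gamma_parity[of u v V] bipartite_with_no_edge[OF bip, of "f u" "f v"]
        by (auto simp: f_od)
    qed
  qed

  show thesis
  proof
    show "finite V"
      by (simp add: V_def)
    show "V \<subseteq> {0<..}"
      by (auto simp: V_def ev_def od_def)
    have "verts (Gamma V) = V"
      by (simp add: Gamma_def)
    then show "graph_isomorphic (Gamma V) G"
      unfolding graph_isomorphic_def using bij iso by auto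
  qed
qed

theorem theorem3p2:
  "(\<forall>V :: nat set. finite V \<and> V \<noteq> {} \<and> V \<subseteq> {0<..} \<and> even (Max V) \<and> odd (Min V) \<longrightarrow>
      ferrers_graph_with (Gamma V) (sorted_list_of_set (evens V)) (sorted_list_of_set (odds V)) \<and>
      ferrers_partition (Gamma V) (sorted_list_of_set (evens V)) = partition_type V) \<and>
   (\<forall>G :: 'a graph. ferrers_graph G \<longrightarrow>
      (\<exists>V :: nat set. finite V \<and> V \<subseteq> {0<..} \<and> graph_isomorphic (Gamma V) G))"
  using ferrers_graph_with_Gamma ferrers_partition_Gamma ferrers_graph_realizable by metis

end
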